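(* Let $\mu$ be a box-like self-affine measure of separated type and assume that $\tau_1$ and $\tau_2$ are differentiable at $q=1$. Then $\gamma$ is differentiable at $q=1$ with \[ \gamma'(1)=\begin{cases}\min\{\gamma_A'(1),\gamma_B'(1)\}&\text{if }\min\{\gamma_A'(1),\gamma_B'(1)\}\geq\tau_1'(1)+\tau_2'(1),\\[4pt]\max\{\gamma_A'(1),\gamma_B'(1)\}&\text{if }\max\{\gamma_A'(1),\gamma_B'(1)\}\leq\tau_1'(1)+\tau_2'(1).\end{cases} \]
   Context: Box-like self-affine measure of separated type: $\mathcal I$ is a finite index set with $|\mathcal I|\ge2$; for each $i\in\mathcal I$, $S_i:\mathbb{R}^2\to\mathbb{R}^2$ is an affine map with linear part $\begin{pmatrix}\pm c_i&0\\0&\pm d_i\end{pmatrix}$, $c_i,d_i\in(0,1)$ (signs depending on $i$), and $S_i([0,1]^2)\subseteq[0,1]^2$; $(p_i)_{i\in\mathcal I}$ is a probability vector with all $p_i\in(0,1)$; $\mu$ is the unique Borel probability measure with $\mu=\sum_{i\in\mathcal I}p_i\,\mu\circ S_i^{-1}$. For a compactly supported Borel probability measure $\nu$, $\tau_\nu(q)=\lim_{\delta\to0}\log\int_{\operatorname{supp}\nu}\nu(B(x,\delta))^{q-1}d\nu(x)/(-\log\delta)$ when the limit exists ($L^q$-spectrum). Let $\pi_1(x,y)=x$, $\pi_2(x,y)=y$, $\pi_j(\mu)=\mu\circ\pi_j^{-1}$, and $\tau_j(q)=\tau_{\pi_j(\mu)}(q)$, which exists for all $q\ge0$. For $\mathbf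 i=(i_1,\dots,i_k)\in\mathcal I^k$ put $p(\mathbf i)=p_{i_1}\cdots p_{i_k}$, $c_{\mathbf i}=c_{i_1}\cdots c_{i_k}$, $d_{\mathbf i}=d_{i_1}\cdots d_{i_k}$, $\alpha_1(\mathbf i)=\max\{c_{\mathbf i},d_{\mathbf i}\}$, $\alpha_2(\mathbf i)=\min\{c_{\mathbf i},d_{\mathbf i}\}$, and $\tau_{\mathbf i}=\tau_1$ if $c_{\mathbf i}\ge d_{\mathbf i}$, $\tau_{\mathbf i}=\tau_2$ otherwise. For $s\in\mathbb{R}$, $q\ge0$ let $\psi^{s,q}(\mathbf i)=p(\mathbf i)^q\alpha_1(\mathbf i)^{\tau_{\mathbf i}(q)}\alpha_2(\mathbf i)^{s-\tau_{\mathbf i}(q)}$, $\Psi_k^{s,q}=\sum_{\mathbf i\in\mathcal I^k}\psi^{s,q}(\mathbf i)$, $P(s,q)=\lim_{k\to\infty}(\Psi_k^{s,q})^{1/k}$ (the limit exists), and let $\gamma(q)$ be the unique real number with $P(\gamma(q),q)=1$. The functions $\gamma_A,\gamma_B:[0,\infty)\to\mathbb{R}$ are defined by $\sum_{i\in\mathcal I}p_i^q\,c_i^{\tau_1(q)}d_i^{\gamma_A(q)-\tau_1(q)}=1$ and $\sum_{i\in\mathcal I}p_i^q\,d_i^{\tau_2(q)}c_i^{\gamma_B(q)-\tau_2(q)}=1$; they are differentiable at $1$ whenever $\tau_1$, respectively $\tau_2$, is. *)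

theory Defs
  imports "HOL-Analysis.Analysis" "HOL-Probability.Probability"
begin

definition measure_support :: "'a::topological_space measure \<Rightarrow> 'a set" where
  "measure_support \<nu> = {x. \<forall>U. open U \<and> x \<in> U \<longrightarrow> emeasure \<nu> U > 0}"

text \<open>Balls are closed; replacing them by open balls does not change the limit.
  As usual for \<^const>\<open>Lim\<close>, the value is unspecified when the limit does not exist.\<close>

definition Lq_spectrum :: "'a::metric_space measure \<Rightarrow> real \<Rightarrow> real" where
  "Lq_spectrum \<nu> q =
     Lim (at_right 0)
       (\<lambda>\<delta>. ln (LINT x:measure_support \<nu>|\<nu>. measure \<nu> (cball x \<delta>) powr (q - 1)) / (- ln \<delta>))"

text \<open>Uniqueness of the self-affine measure is a theorem (all \<open>S i\<close> are contractions), so it suffices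
  to require that \<open>\<mu>\<close> is a Borel probability measure satisfying the invariance equation. No separation
  condition on the images of the unit square is imposed.\<close>

locale box_like_separated =
  fixes I :: "'i set"
    and S :: "'i \<Rightarrow> real \<times> real \<Rightarrow> real \<times> real"
    and c d p :: "'i \<Rightarrow> real"
    and \<mu> :: "(real \<times> real) measure"
  assumes finite_I: "finite I"
    and card_I: "card I \<ge> 2"
    and c_range: "\<And>i. i \<in> I \<Longrightarrow> c i \<in> {0<..<1}"
    and d_range: "\<And>i. i \<in> I \<Longrightarrow> d i \<in> {0<..<1}"
    and S_affine: "\<And>i. i \<in> I \<Longrightarrow>
      \<exists>\<sigma>\<in>{1, -1}. \<exists>\<rho>\<in>{1, -1}. \<exists>a b. \<forall>x y. S i (x, y) = (\<sigma> * c i * x + a, \<rho> * d i * y + b)"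
    and S_square: "\<And>i. i \<in> I \<Longrightarrow> S i ` ({0..1} \<times> {0..1}) \<subseteq> {0..1} \<times> {0..1}"
    and p_range: "\<And>i. i \<in> I \<Longrightarrow> p i \<in> {0<..<1}"
    and p_sum: "(\<Sum>i\<in>I. p i) = 1"
    and prob_mu: "prob_space \<mu>"
    and sets_mu: "sets \<mu> = sets borel"
    and mu_invariant: "\<And>A. A \<in> sets borel \<Longrightarrow> measure \<mu> A = (\<Sum>i\<in>I. p i * measure \<mu> (S i -` A))"

definition tau1 :: "(real \<times> real) measure \<Rightarrow> real \<Rightarrow> real" where
  "tau1 \<mu> = Lq_spectrum (distr \<mu> borel fst)"

definition tau2 :: "(real \<times> real) measure \<Rightarrow> real \<Rightarrow> real" where
  "tau2 \<mu> = Lq_spectrum (distr \<mu> borel snd)"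

definition words :: "'i set \<Rightarrow> nat \<Rightarrow> 'i list set" where
  "words I k = {w. set w \<subseteq> I \<and> length w = k}"

definition word_prod :: "('i \<Rightarrow> real) \<Rightarrow> 'i list \<Rightarrow> real" where
  "word_prod f w = prod_list (map f w)"

definition alpha1 :: "('i \<Rightarrow> real) \<Rightarrow> ('i \<Rightarrow> real) \<Rightarrow> 'i list \<Rightarrow> real" where
  "alpha1 c d w = max (word_prod c w) (word_prod d w)"

definition alpha2 :: "('i \<Rightarrow> real) \<Rightarrow> ('i \<Rightarrow> real) \<Rightarrow> 'i list \<Rightarrow> real" where
  "alpha2 c d w = min (word_prod c w) (word_prod d w)"

definition tau_word ::
  "('i \<Rightarrow> real) \<Rightarrow> ('i \<Rightarrow> real) \<Rightarrow> (real \<times> real) measure \<Rightarrow> 'i list \<Rightarrow> real \<Rightarrow> real" where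
  "tau_word c d \<mu> w = (if word_prod c w \<ge> word_prod d w then tau1 \<mu> else tau2 \<mu>)"

definition psi ::
  "('i \<Rightarrow> real) \<Rightarrow> ('i \<Rightarrow> real) \<Rightarrow> ('i \<Rightarrow> real) \<Rightarrow> (real \<times> real) measure
    \<Rightarrow> real \<Rightarrow> real \<Rightarrow> 'i list \<Rightarrow> real" where
  "psi c d p \<mu> s q w =
     word_prod p w powr q * alpha1 c d w powr tau_word c d \<mu> w q
       * alpha2 c d w powr (s - tau_word c d \<mu> w q)"

definition Psi ::
  "'i set \<Rightarrow> ('i \<Rightarrow> real) \<Rightarrow> ('i \<Rightarrow> real) \<Rightarrow> ('i \<Rightarrow> real) \<Rightarrow> (real \<times> real) measure
    \<Rightarrow> real \<Rightarrow> real \<Rightarrow> nat \<Rightarrow> real" where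
  "Psi I c d p \<mu> s q k = (\<Sum>w\<in>words I k. psi c d p \<mu> s q w)"

definition pressure ::
  "'i set \<Rightarrow> ('i \<Rightarrow> real) \<Rightarrow> ('i \<Rightarrow> real) \<Rightarrow> ('i \<Rightarrow> real) \<Rightarrow> (real \<times> real) measure
    \<Rightarrow> real \<Rightarrow> real \<Rightarrow> real" where
  "pressure I c d p \<mu> s q = lim (\<lambda>k. root k (Psi I c d p \<mu> s q k))"

text \<open>The functions \<open>gamma\<close>, \<open>gamma_A\<close>, \<open>gamma_B\<close> are meant for \<open>q \<ge> 0\<close> only; the values at negative \<open>q\<close>
  are irrelevant to differentiability at \<open>1\<close>.\<close>

definition gamma ::
  "'i set \<Rightarrow> ('i \<Rightarrow> real) \<Rightarrow> ('i \<Rightarrow> real) \<Rightarrow> ('i \<Rightarrow> real) \<Rightarrow> (real \<times> real) measure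
    \<Rightarrow> real \<Rightarrow> real" where
  "gamma I c d p \<mu> q = (THE s. pressure I c d p \<mu> s q = 1)"

definition gamma_A ::
  "'i set \<Rightarrow> ('i \<Rightarrow> real) \<Rightarrow> ('i \<Rightarrow> real) \<Rightarrow> ('i \<Rightarrow> real) \<Rightarrow> (real \<times> real) measure
    \<Rightarrow> real \<Rightarrow> real" where
  "gamma_A I c d p \<mu> q =
     (THE g. (\<Sum>i\<in>I. p i powr q * c i powr tau1 \<mu> q * d i powr (g - tau1 \<mu> q)) = 1)"

definition gamma_B ::
  "'i set \<Rightarrow> ('i \<Rightarrow> real) \<Rightarrow> ('i \<Rightarrow> real) \<Rightarrow> ('i \<Rightarrow> real) \<Rightarrow> (real \<times> real) measure
    \<Rightarrow> real \<Rightarrow> real" where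
  "gamma_B I c d p \<mu> q =
     (THE g. (\<Sum>i\<in>I. p i powr q * d i powr tau2 \<mu> q * c i powr (g - tau2 \<mu> q)) = 1)"

end

theory Submission
  imports Defs
begin

text \<open>
  Since \<open>\<tau>\<^sub>1(1) = \<tau>\<^sub>2(1) = 0\<close>, everything near \<open>q = 1\<close> is read off from the entropy \<open>h\<close> and the
  Lyapunov exponents \<open>\<chi>\<^sub>c\<close>, \<open>\<chi>\<^sub>d\<close> of the probability vector \<open>p\<close>. By the symmetry exchanging the
  coordinates let \<open>\<chi>\<^sub>c \<le> \<chi>\<^sub>d\<close>, and put
  \<open>g(q) = ((\<chi>\<^sub>d - \<chi>\<^sub>c) \<tau>\<^sub>1(q) - (q - 1) h) / \<chi>\<^sub>d\<close>. Under the Bernoulli measure of \<open>p\<close> a word typically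
  satisfies \<open>c\<^sub>w \<ge> d\<^sub>w\<close> up to an error of order \<open>sqrt k\<close> in the logarithms, so Jensen's inequality
  gives \<open>log P(s, q) \<ge> \<chi>\<^sub>d (g(q) - s)\<close>. Conversely, the weight of a word is at most the larger of
  two multiplicative weights, and even at most the smaller one if \<open>s \<ge> \<tau>\<^sub>1(q) + \<tau>\<^sub>2(q)\<close>; expanding the
  exponential to second order then yields \<open>P(s, q) \<le> 1\<close> at \<open>s = g(q) + M (q - 1)\<^sup>2\<close>. Hence
  \<open>g(q) \<le> \<gamma>(q) \<le> g(q) + M (q - 1)\<^sup>2\<close>, and the same bounds hold for \<open>\<gamma>\<^sub>A\<close>. So \<open>\<gamma>'(1)\<close> is
  \<open>\<gamma>\<^sub>A'(1)\<close> or \<open>\<gamma>\<^sub>B'(1)\<close> according to which Lyapunov exponent is larger, and the two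
  differ from \<open>\<tau>\<^sub>1'(1) + \<tau>\<^sub>2'(1)\<close> by \<open>N / \<chi>\<^sub>d\<close> and \<open>N / \<chi>\<^sub>c\<close> with the same \<open>N\<close>.
\<close>

section \<open>Real-variable preliminaries: subadditive sequences, roots, second-order
  comparison\<close>

text \<open>The limit is the infimum of \<open>u n / real n\<close>; the linear lower bound keeps
  that infimum finite, so the limit is a real number.\<close>

lemma fekete:
  fixes u :: "nat \<Rightarrow> real"
  assumes sub: "\<And>m n. u (m + n) \<le> u m + u n"
    and lower: "\<And>n. C * real n \<le> u n"
  shows "convergent (\<lambda>n. u n / real n)"
proof -
  define l where "l = (INF n\<in>{1..}. u n / real n)"
  have bdd: "bdd_below ((\<lambda>n. u n / real n) ` {1..})"
    using lower by (intro bdd_belowI[of _ C]) (auto simp: field_simps)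
  have l_le: "l \<le> u n / real n" if "n \<ge> 1" for n
    unfolding l_def using that by (intro cINF_lower[OF bdd]) auto
  have mult: "u (N * j + r) \<le> real j * u N + u r" for N j r
  proof (induction j)
    case (Suc j)
    have "u (N * Suc j + r) \<le> u N + u (N * j + r)"
      using sub[of N "N * j + r"] by (simp add: algebra_simps)
    with Suc show ?case by (simp add: algebra_simps)
  qed simp
  have "(\<lambda>n. u n / real n) \<longlonglongrightarrow> l"
  proof (rule order_tendstoI)
    fix y assume "y < l"
    then show "\<forall>\<^sub>F n in sequentially. y < u n / real n"
      using l_le by (intro eventually_sequentiallyI[of 1]) (rule less_le_trans)
  next
    fix y assume "l < y"
    then have "\<exists>n\<in>{1..}. u n / real n < y"
      unfolding l_def using bdd by (subst (asm) cINF_less_iff) simp_all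
    then obtain N where N: "N \<ge> 1" "u N / real N < y" by auto
    define D where "D = Max ((\<lambda>r. \<bar>u r\<bar>) ` {..<N})"
    have D: "u r \<le> D" if "r < N" for r
      unfolding D_def using that by (intro abs_le_D1[OF Max_ge]) auto
    \<comment> \<open>Division with remainder, \<open>n = N * j + r\<close>: the tail costs at most
      \<open>D\<close>, and replacing \<open>j\<close> by \<open>n / N\<close> costs at most
      \<open>\<bar>u N\<bar>\<close>, whatever the sign of \<open>u N\<close>.\<close>
    have bound: "u n / real n \<le> u N / real N + (D + \<bar>u N\<bar>) / real n" if n: "n \<ge> 1" for n
    proof -
      define j r where "j = n div N" and "r = n mod N"
      have nj: "n = N * j + r" "r < N" using N by (auto simp: j_def r_def)
      have "real j * u N = real n * (u N / real N) - (real r / real N) * u N"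
        using N by (simp add: nj(1) field_simps)
      moreover have "- ((real r / real N) * u N) \<le> \<bar>u N\<bar>"
      proof -
        have "\<bar>real r / real N\<bar> \<le> 1" using nj N by auto
        then have "\<bar>(real r / real N) * u N\<bar> \<le> 1 * \<bar>u N\<bar>"
          unfolding abs_mult by (intro mult_right_mono) auto
        then show ?thesis by linarith
      qed
      ultimately have "u n \<le> real n * (u N / real N) + (D + \<bar>u N\<bar>)"
        using mult[of N j r] D[OF nj(2)] unfolding nj(1)[symmetric] by linarith
      then show ?thesis using n by (simp add: field_simps)
    qed
    have "(\<lambda>n. u N / real N + (D + \<bar>u N\<bar>) / real n) \<longlonglongrightarrow> u N / real N + 0"
      by (intro tendsto_intros lim_const_over_n)
    then have "\<forall>\<^sub>F n in sequentially. u N / real N + (D + \<bar>u N\<bar>) / real n < y"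
      using N(2) by (auto dest: order_tendstoD(2))
    with eventually_ge_at_top[of 1] show "\<forall>\<^sub>F n in sequentially. u n / real n < y"
      by eventually_elim (rule le_less_trans[OF bound])
  qed
  then show ?thesis by (auto simp: convergent_def)
qed

text \<open>All the exponents are defined by \<open>THE\<close>. The intermediate value theorem
  gives a root in the interval and strict monotonicity its uniqueness, so bounds on \<open>f\<close>
  at two points become bounds on the exponent.\<close>

lemma the_root_between:
  fixes f :: "real \<Rightarrow> real"
  assumes "continuous_on UNIV f" and decr: "\<And>s s'. s < s' \<Longrightarrow> f s' < f s"
    and "l \<le> u" "v \<le> f l" "f u \<le> v"
  shows "l \<le> (THE s. f s = v) \<and> (THE s. f s = v) \<le> u"
proof -
  obtain s where s: "l \<le> s" "s \<le> u" "f s = v"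
    using IVT2'[of f u v l] assms continuous_on_subset by blast
  then have "(THE s. f s = v) = s"
    using decr by (intro the_equality) (metis linorder_neqE_linordered_idom less_irrefl)+
  with s show ?thesis by simp
qed

text \<open>The bounds hold at \<open>a\<close> itself, which forces \<open>f a = g a\<close>; the
  difference \<open>f - g\<close> is then of second order and has derivative zero.\<close>

lemma DERIV_quadratic_sandwich:
  fixes f g :: "real \<Rightarrow> real"
  assumes g: "(g has_real_derivative D) (at a)"
    and fg: "\<forall>\<^sub>F q in nhds a. g q \<le> f q \<and> f q \<le> g q + M * (q - a)\<^sup>2"
  shows "(f has_real_derivative D) (at a)"
proof -
  define e where "e q = f q - g q" for q
  have ea: "e a = 0" using eventually_nhds_x_imp_x[OF fg] by (simp add: e_def)
  have ev: "\<forall>\<^sub>F q in at a. q \<noteq> a \<and> \<bar>e q\<bar> \<le> M * (q - a)\<^sup>2"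
    using fg unfolding eventually_at_filter e_def by eventually_elim auto
  have "((\<lambda>q. (e q - e a) / (q - a)) \<longlongrightarrow> 0) (at a)"
  proof (rule Lim_null_comparison)
    show "\<forall>\<^sub>F q in at a. norm ((e q - e a) / (q - a)) \<le> M * \<bar>q - a\<bar>"
      using ev
    proof eventually_elim
      case (elim q)
      then have "\<bar>e q\<bar> \<le> (M * \<bar>q - a\<bar>) * \<bar>q - a\<bar>"
        by (simp add: power2_eq_square mult.assoc flip: abs_mult)
      with elim show ?case by (simp add: ea divide_le_eq)
    qed
    have "((\<lambda>q. M * \<bar>q - a\<bar>) \<longlongrightarrow> M * \<bar>a - a\<bar>) (at a)" by (intro tendsto_intros)
    then show "((\<lambda>q. M * \<bar>q - a\<bar>) \<longlongrightarrow> 0) (at a)" by simp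
  qed
  then have "(e has_real_derivative 0) (at a)" by (simp add: has_field_derivative_iff)
  from DERIV_add[OF g this] show ?thesis by (simp add: e_def)
qed

lemma DERIV_zero_eventually_linear_bound:
  fixes f :: "real \<Rightarrow> real"
  assumes "(f has_real_derivative D) (at a)" "f a = 0"
  shows "\<forall>\<^sub>F q in nhds a. \<bar>f q\<bar> \<le> (\<bar>D\<bar> + 1) * \<bar>q - a\<bar>"
proof -
  have "((\<lambda>q. \<bar>f q / (q - a)\<bar>) \<longlongrightarrow> \<bar>D\<bar>) (at a)"
    using assms by (intro tendsto_rabs) (simp add: has_field_derivative_iff)
  then have "\<forall>\<^sub>F q in at a. \<bar>f q / (q - a)\<bar> < \<bar>D\<bar> + 1" by (rule order_tendstoD) simp
  then show ?thesis
    unfolding eventually_at_filter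
  proof eventually_elim
    case (elim q)
    then show ?case by (cases "q = a") (auto simp: assms(2) divide_less_eq less_imp_le)
  qed
qed

lemma exp_le_quadratic:
  fixes x :: real
  assumes "\<bar>x\<bar> \<le> 1"
  shows "exp x \<le> 1 + x + x\<^sup>2"
proof (cases "x \<ge> 0")
  case True
  then show ?thesis using assms exp_bound by simp
next
  case False
  \<comment> \<open>The product equals \<open>1 - x^3\<close>, which is at least 1 for negative
    \<open>x\<close>.\<close>
  have "1 \<le> (1 + x + x\<^sup>2) * (1 - x)"
    using False mult_nonpos_nonneg[of x "x * x"] by (simp add: algebra_simps power2_eq_square)
  also have "\<dots> \<le> (1 + x + x\<^sup>2) * exp (- x)"
    using exp_ge_add_one_self[of "- x"] assms False by (intro mult_left_mono) auto
  finally show ?thesis by (simp add: exp_minus field_simps)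
qed

section \<open>Sums over words and multiplicative functions\<close>

lemma finite_words: "finite I \<Longrightarrow> finite (words I k)"
  unfolding words_def by (rule finite_lists_length_eq)

lemma words_0 [simp]: "words I 0 = {[]}"
  by (auto simp: words_def)

lemma sum_words_add:
  "(\<Sum>w\<in>words I (m + n). f w) = (\<Sum>u\<in>words I m. \<Sum>v\<in>words I n. f (u @ v))"
proof -
  have "bij_betw (\<lambda>(u, v). u @ v) (words I m \<times> words I n) (words I (m + n))"
  proof (rule bij_betwI[where g = "\<lambda>w. (take m w, drop m w)"])
    show "(\<lambda>w. (take m w, drop m w)) \<in> words I (m + n) \<rightarrow> words I m \<times> words I n"
      by (auto simp: words_def dest: in_set_takeD in_set_dropD)
  qed (auto simp: words_def)
  then show ?thesis
    by (simp add: sum.cartesian_product flip: sum.reindex_bij_betw) (simp add: case_prod_unfold)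
qed

lemma sum_words_Suc:
  fixes f :: "'a list \<Rightarrow> 'b::comm_monoid_add"
  shows
  "(\<Sum>w\<in>words I (Suc k). f w) = (\<Sum>i\<in>I. \<Sum>v\<in>words I k. f (i # v))"
proof -
  have "words I 1 = (\<lambda>i. [i]) ` I" by (auto simp: words_def length_Suc_conv)
  then have "(\<Sum>u\<in>words I 1. g u) = (\<Sum>i\<in>I. g [i])" for g :: "'a list \<Rightarrow> 'b"
    by (simp add: sum.reindex inj_on_def)
  then show ?thesis using sum_words_add[of f I 1 k] by simp
qed

lemma word_prod_Nil [simp]: "word_prod f [] = 1"
  and word_prod_Cons [simp]: "word_prod f (i # w) = f i * word_prod f w"
  and word_prod_append: "word_prod f (v @ w) = word_prod f v * word_prod f w"
  by (simp_all add: word_prod_def)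

lemma sum_words_word_prod:
  fixes f :: "'i \<Rightarrow> real"
  shows "(\<Sum>w\<in>words I k. word_prod f w) = (\<Sum>i\<in>I. f i) ^ k"
  by (induction k) (simp_all add: sum_words_Suc flip: sum_distrib_left sum_distrib_right)

lemma word_prod_pos: "(\<And>i. i \<in> I \<Longrightarrow> f i > 0) \<Longrightarrow> w \<in> words I k \<Longrightarrow> word_prod f w > 0"
  by (induction w arbitrary: k) (auto simp: words_def)

lemma ln_word_prod:
  assumes "\<And>i. i \<in> I \<Longrightarrow> f i > 0" "w \<in> words I k"
  shows "ln (word_prod f w) = (\<Sum>i\<leftarrow>w. ln (f i))"
  using assms(2)
proof (induction w arbitrary: k)
  case (Cons i w)
  then have "i \<in> I" "w \<in> words I (length w)" by (auto simp: words_def)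
  then have "f i > 0" "word_prod f w > 0" using assms(1) word_prod_pos by blast+
  then show ?case using Cons.IH[OF \<open>w \<in> words I (length w)\<close>] by (simp add: ln_mult)
qed simp

section \<open>Weights of letters and words, and the pressure\<close>

text \<open>For \<open>f = p\<close> this is the entropy, for \<open>f = c\<close> and
  \<open>f = d\<close> the two Lyapunov exponents.\<close>

definition mean_neg_log :: "'i set \<Rightarrow> ('i \<Rightarrow> real) \<Rightarrow> ('i \<Rightarrow> real) \<Rightarrow> real" where
  "mean_neg_log I p f = (\<Sum>i\<in>I. p i * - ln (f i))"

text \<open>With \<open>t\<close> the value of \<open>tau1\<close> at \<open>q\<close>, the sum over
  letters is the one that defines \<open>gamma_A\<close>; exchanging \<open>c\<close> and
  \<open>d\<close> and using \<open>tau2\<close> gives \<open>gamma_B\<close>.\<close>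

definition letter_weight ::
  "('i \<Rightarrow> real) \<Rightarrow> ('i \<Rightarrow> real) \<Rightarrow> ('i \<Rightarrow> real) \<Rightarrow> real \<Rightarrow> real \<Rightarrow> real \<Rightarrow> 'i \<Rightarrow> real" where
  "letter_weight c d p q t s i = p i powr q * c i powr t * d i powr (s - t)"

text \<open>This is \<open>psi\<close> with the values of the two spectra replaced by free numbers
  \<open>t1\<close> and \<open>t2\<close>, so the estimates below involve no measure.\<close>

definition word_weight ::
  "('i \<Rightarrow> real) \<Rightarrow> ('i \<Rightarrow> real) \<Rightarrow> ('i \<Rightarrow> real) \<Rightarrow> real \<Rightarrow> real \<Rightarrow> real \<Rightarrow> real \<Rightarrow> 'i list \<Rightarrow> real" where
  "word_weight c d p q t1 t2 s w =
     (if word_prod d w \<le> word_prod c w then word_prod (letter_weight c d p q t1 s) w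
      else word_prod (letter_weight d c p q t2 s) w)"

definition word_weight_sum ::
  "'i set \<Rightarrow> ('i \<Rightarrow> real) \<Rightarrow> ('i \<Rightarrow> real) \<Rightarrow> ('i \<Rightarrow> real) \<Rightarrow> real \<Rightarrow> real \<Rightarrow> real \<Rightarrow> real \<Rightarrow> nat \<Rightarrow> real" where
  "word_weight_sum I c d p q t1 t2 s k = (\<Sum>w\<in>words I k. word_weight c d p q t1 t2 s w)"

definition log_pressure ::
  "'i set \<Rightarrow> ('i \<Rightarrow> real) \<Rightarrow> ('i \<Rightarrow> real) \<Rightarrow> ('i \<Rightarrow> real) \<Rightarrow> real \<Rightarrow> real \<Rightarrow> real \<Rightarrow> real \<Rightarrow> real" where
  "log_pressure I c d p q t1 t2 s = lim (\<lambda>k. ln (word_weight_sum I c d p q t1 t2 s k) / real k)"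

text \<open>The zero in \<open>s\<close> of the \<open>p\<close>-mean of the exponent in
  \<open>letter_weight_eq_exp\<close>, that is, the solution of the linearised equation for
  \<open>gamma_A\<close>.\<close>

definition root_tangent ::
  "'i set \<Rightarrow> ('i \<Rightarrow> real) \<Rightarrow> ('i \<Rightarrow> real) \<Rightarrow> ('i \<Rightarrow> real) \<Rightarrow> real \<Rightarrow> real \<Rightarrow> real" where
  "root_tangent I c d p q t =
     ((mean_neg_log I p d - mean_neg_log I p c) * t - (q - 1) * mean_neg_log I p p) / mean_neg_log I p d"

text \<open>Purely numerical data, with assumptions symmetric in \<open>c\<close> and
  \<open>d\<close>: through \<open>swapped\<close>, every result is also available with the
  coordinates exchanged.\<close>

locale weighted_system =
  fixes I :: "'i set" and c d p :: "'i \<Rightarrow> real"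
  assumes finite_I: "finite I"
    and c_range: "\<And>i. i \<in> I \<Longrightarrow> 0 < c i \<and> c i < 1"
    and d_range: "\<And>i. i \<in> I \<Longrightarrow> 0 < d i \<and> d i < 1"
    and p_range: "\<And>i. i \<in> I \<Longrightarrow> 0 < p i \<and> p i < 1"
    and p_sum: "(\<Sum>i\<in>I. p i) = 1"
begin

lemma swapped: "weighted_system I d c p"
  using finite_I c_range d_range p_range p_sum by unfold_locales

lemma I_nonempty: "I \<noteq> {}"
  using p_sum by auto

text \<open>Pulling out the factor \<open>p i\<close> makes the weight a perturbation of the
  probability vector, with a small exponent when \<open>q\<close> is near 1 and \<open>s\<close>,
  \<open>t\<close> are near 0.\<close>

lemma letter_weight_eq_exp:
  "i \<in> I \<Longrightarrow> letter_weight c d p q t s i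
     = p i * exp ((q - 1) * ln (p i) + t * ln (c i) + (s - t) * ln (d i))"
  using c_range[of i] d_range[of i] p_range[of i]
  by (simp add: letter_weight_def powr_def exp_add left_diff_distrib exp_diff)

lemma letter_weight_pos: "i \<in> I \<Longrightarrow> letter_weight c d p q t s i > 0"
  using letter_weight_eq_exp p_range by simp

lemma mean_neg_log_pos: "mean_neg_log I p c > 0" "mean_neg_log I p d > 0"
  unfolding mean_neg_log_def using I_nonempty finite_I c_range d_range p_range
  by (auto intro!: sum_pos mult_pos_neg)

text \<open>Under the weights \<open>word_prod p\<close>, the letters of a word are independent with
  law \<open>p\<close>; this is linearity of expectation.\<close>

lemma sum_additive:
  "(\<Sum>w\<in>words I k. word_prod p w * (\<Sum>i\<leftarrow>w. l i)) = real k * (\<Sum>i\<in>I. p i * l i)"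
proof (induction k)
  case (Suc k)
  have "(\<Sum>w\<in>words I (Suc k). word_prod p w * (\<Sum>i\<leftarrow>w. l i))
      = (\<Sum>i\<in>I. (p i * l i) * (\<Sum>v\<in>words I k. word_prod p v)
          + p i * (\<Sum>v\<in>words I k. word_prod p v * (\<Sum>i\<leftarrow>v. l i)))"
    by (simp add: sum_words_Suc sum_distrib_left algebra_simps flip: sum.distrib)
  also have "\<dots> = (\<Sum>i\<in>I. p i * l i) + real k * (\<Sum>i\<in>I. p i * l i)"
    by (simp add: Suc sum_words_word_prod p_sum sum.distrib flip: sum_distrib_right)
  finally show ?case by (simp add: algebra_simps)
qed simp

text \<open>The variance of a sum of independent centred variables: the mixed terms have mean
  zero.\<close>

lemma sum_centred_square:
  assumes "(\<Sum>i\<in>I. p i * l i) = 0"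
  shows "(\<Sum>w\<in>words I k. word_prod p w * (\<Sum>i\<leftarrow>w. l i)\<^sup>2) = real k * (\<Sum>i\<in>I. p i * (l i)\<^sup>2)"
proof (induction k)
  case (Suc k)
  have "(\<Sum>w\<in>words I (Suc k). word_prod p w * (\<Sum>i\<leftarrow>w. l i)\<^sup>2)
      = (\<Sum>i\<in>I. (p i * (l i)\<^sup>2) * (\<Sum>v\<in>words I k. word_prod p v)
          + 2 * (p i * l i) * (\<Sum>v\<in>words I k. word_prod p v * (\<Sum>i\<leftarrow>v. l i))
          + p i * (\<Sum>v\<in>words I k. word_prod p v * (\<Sum>i\<leftarrow>v. l i)\<^sup>2))"
    by (simp add: sum_words_Suc sum_distrib_left sum_distrib_right algebra_simps power2_sum flip: sum.distrib)
  also have "\<dots> = (\<Sum>i\<in>I. p i * (l i)\<^sup>2) + real k * (\<Sum>i\<in>I. p i * (l i)\<^sup>2)"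
    by (simp add: Suc sum_words_word_prod p_sum sum.distrib sum_additive assms flip: sum_distrib_right)
  finally show ?case by (simp add: algebra_simps)
qed simp

section \<open>Word weights as maxima or minima of two multiplicative functions\<close>

lemma word_prod_pos_system [simp]:
  assumes "w \<in> words I k"
  shows "word_prod p w > 0" "word_prod c w > 0" "word_prod d w > 0"
    "word_prod (letter_weight c d p q t s) w > 0"
  using assms c_range d_range p_range letter_weight_pos by (meson word_prod_pos)+

lemma word_prod_letter_weight:
  assumes "w \<in> words I k"
  shows "word_prod (letter_weight c d p q t s) w
    = word_prod p w powr q * word_prod c w powr t * word_prod d w powr (s - t)"
  using assms
proof (induction w arbitrary: k)
  case (Cons i w)
  then have i: "i \<in> I" and w: "w \<in> words I (length w)" by (auto simp: words_def)
  then show ?case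
    using word_prod_pos_system[OF w] c_range[OF i] d_range[OF i] p_range[OF i] Cons.IH[OF w]
    by (simp add: letter_weight_def powr_mult)
qed simp

text \<open>The powers of \<open>p\<close> cancel in the quotient. Which weight is larger thus
  depends only on the sign of \<open>t1 + t2 - s\<close> and on whether \<open>d\<close> or
  \<open>c\<close> has the larger product along the word.\<close>

lemma word_prod_swapped_letter_weight:
  assumes "w \<in> words I k"
  shows "word_prod (letter_weight d c p q t2 s) w
    = word_prod (letter_weight c d p q t1 s) w * (word_prod d w / word_prod c w) powr (t1 + t2 - s)"
  using word_prod_pos_system[OF assms]
  by (simp add: word_prod_letter_weight[OF assms] powr_divide powr_diff powr_add field_simps
      weighted_system.word_prod_letter_weight[OF swapped assms])

text \<open>The exponent \<open>t1 + t2 - s\<close> is nonnegative, so the branch selected in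
  \<open>word_weight\<close> is the larger one.\<close>

lemma word_weight_eq_max:
  assumes "w \<in> words I k" "s \<le> t1 + t2"
  shows "word_weight c d p q t1 t2 s w
    = max (word_prod (letter_weight c d p q t1 s) w) (word_prod (letter_weight d c p q t2 s) w)"
proof -
  let ?r = "word_prod d w / word_prod c w"
  have "?r powr (t1 + t2 - s) \<le> 1" if "word_prod d w \<le> word_prod c w"
    using that assms(2) word_prod_pos_system[OF assms(1)] by (intro powr_le1) auto
  moreover have "?r powr (t1 + t2 - s) \<ge> 1" if "\<not> word_prod d w \<le> word_prod c w"
    using that assms(2) word_prod_pos_system[OF assms(1)] by (intro ge_one_powr_ge_zero) auto
  ultimately show ?thesis
    using word_prod_pos_system(4)[OF assms(1), of q t1 s]
    by (auto simp: word_weight_def word_prod_swapped_letter_weight[OF assms(1), of q t2 s t1] max_def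
        mult_le_cancel_left1 mult_le_cancel_left2)
qed

text \<open>The exponent now has the opposite sign, so the same branch is the smaller one.\<close>

lemma word_weight_eq_min:
  assumes "w \<in> words I k" "t1 + t2 \<le> s"
  shows "word_weight c d p q t1 t2 s w
    = min (word_prod (letter_weight c d p q t1 s) w) (word_prod (letter_weight d c p q t2 s) w)"
proof -
  let ?r = "word_prod d w / word_prod c w"
  have "?r powr (t1 + t2 - s) \<ge> 1" if "word_prod d w \<le> word_prod c w"
    using powr_mono'[of "t1 + t2 - s" 0 ?r] that assms(2) word_prod_pos_system[OF assms(1)] by simp
  moreover have "?r powr (t1 + t2 - s) \<le> 1" if "\<not> word_prod d w \<le> word_prod c w"
    using powr_mono[of "t1 + t2 - s" 0 ?r] that assms(2) word_prod_pos_system[OF assms(1)] by simp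
  ultimately show ?thesis
    using word_prod_pos_system(4)[OF assms(1), of q t1 s]
    by (auto simp: word_weight_def word_prod_swapped_letter_weight[OF assms(1), of q t2 s t1] min_def
        mult_le_cancel_left1 mult_le_cancel_left2)
qed

lemma word_weight_pos: "w \<in> words I k \<Longrightarrow> word_weight c d p q t1 t2 s w > 0"
  using weighted_system.word_prod_pos_system(4)[OF swapped] by (simp add: word_weight_def)

lemma words_nonempty: "words I k \<noteq> {}"
proof -
  obtain i where "i \<in> I" using I_nonempty by auto
  then have "replicate k i \<in> words I k" by (auto simp: words_def)
  then show ?thesis by blast
qed

lemma word_weight_sum_pos: "word_weight_sum I c d p q t1 t2 s k > 0"
  unfolding word_weight_sum_def
  by (intro sum_pos finite_words finite_I words_nonempty word_weight_pos)

text \<open>A maximum of two positive multiplicative functions is submultiplicative, and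
  concatenation enumerates the words of length \<open>m + n\<close>.\<close>

lemma word_weight_sum_submult:
  assumes "s \<le> t1 + t2"
  shows "word_weight_sum I c d p q t1 t2 s (m + n)
    \<le> word_weight_sum I c d p q t1 t2 s m * word_weight_sum I c d p q t1 t2 s n"
proof -
  have "word_weight c d p q t1 t2 s (u @ v)
      \<le> word_weight c d p q t1 t2 s u * word_weight c d p q t1 t2 s v"
    if "u \<in> words I m" "v \<in> words I n" for u v
  proof -
    have uv: "u @ v \<in> words I (m + n)" using that by (auto simp: words_def)
    note pos = weighted_system.word_prod_pos_system(4)[OF swapped]
    show ?thesis
      unfolding word_weight_eq_max[OF that(1) assms] word_weight_eq_max[OF that(2) assms]
        word_weight_eq_max[OF uv assms] word_prod_append
      by (intro max.boundedI mult_mono) (use that pos in \<open>auto intro: less_imp_le simp: le_max_iff_disj\<close>)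
  qed
  then show ?thesis
    by (simp add: word_weight_sum_def sum_words_add sum_product sum_mono)
qed

lemma word_weight_sum_supermult:
  assumes "t1 + t2 \<le> s"
  shows "word_weight_sum I c d p q t1 t2 s m * word_weight_sum I c d p q t1 t2 s n
    \<le> word_weight_sum I c d p q t1 t2 s (m + n)"
proof -
  have "word_weight c d p q t1 t2 s u * word_weight c d p q t1 t2 s v
      \<le> word_weight c d p q t1 t2 s (u @ v)"
    if "u \<in> words I m" "v \<in> words I n" for u v
  proof -
    have uv: "u @ v \<in> words I (m + n)" using that by (auto simp: words_def)
    note pos = weighted_system.word_prod_pos_system(4)[OF swapped]
    show ?thesis
      unfolding word_weight_eq_min[OF that(1) assms] word_weight_eq_min[OF that(2) assms]
        word_weight_eq_min[OF uv assms] word_prod_append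
      by (intro min.boundedI mult_mono) (use that pos in \<open>auto intro: less_imp_le simp: min_le_iff_disj\<close>)
  qed
  then show ?thesis
    by (simp add: word_weight_sum_def sum_words_add sum_product sum_mono)
qed

lemma letter_weight_sum_pos: "(\<Sum>i\<in>I. letter_weight c d p q t s i) > 0"
  by (intro sum_pos finite_I I_nonempty letter_weight_pos)

lemma word_weight_sum_le:
  assumes "t1 + t2 \<le> s"
  shows "word_weight_sum I c d p q t1 t2 s k \<le> (\<Sum>i\<in>I. letter_weight c d p q t1 s i) ^ k"
  unfolding word_weight_sum_def sum_words_word_prod[symmetric]
  by (intro sum_mono) (simp add: word_weight_eq_min assms)

lemma word_weight_sum_ge:
  assumes "s \<le> t1 + t2"
  shows "(\<Sum>i\<in>I. letter_weight c d p q t1 s i) ^ k \<le> word_weight_sum I c d p q t1 t2 s k"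
  unfolding word_weight_sum_def sum_words_word_prod[symmetric]
  by (intro sum_mono) (simp add: word_weight_eq_max assms)

text \<open>Valid for every \<open>s\<close>, because each word weight is one of the two positive
  multiplicative weights.\<close>

lemma word_weight_sum_le_add:
  "word_weight_sum I c d p q t1 t2 s k
    \<le> (\<Sum>i\<in>I. letter_weight c d p q t1 s i) ^ k + (\<Sum>i\<in>I. letter_weight d c p q t2 s i) ^ k"
  unfolding word_weight_sum_def sum_words_word_prod[symmetric] sum.distrib[symmetric]
  using weighted_system.word_prod_pos_system(4)[OF swapped]
  by (intro sum_mono) (auto simp: word_weight_def intro!: less_imp_le)

text \<open>The weights of words are maxima or minima of two multiplicative functions according to the
  sign of \<open>s - t1 - t2\<close>, so Fekete's lemma applies in both cases.\<close>

lemma tendsto_log_pressure: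
  "(\<lambda>k. ln (word_weight_sum I c d p q t1 t2 s k) / real k) \<longlonglongrightarrow> log_pressure I c d p q t1 t2 s"
proof -
  define Z where "Z = word_weight_sum I c d p q t1 t2 s"
  define a where "a = (\<Sum>i\<in>I. letter_weight c d p q t1 s i)"
  have Z: "Z k > 0" for k unfolding Z_def by (rule word_weight_sum_pos)
  have a: "a > 0" unfolding a_def by (rule letter_weight_sum_pos)
  have "convergent (\<lambda>k. ln (Z k) / real k)"
  proof (cases "s \<le> t1 + t2")
    case True
    show ?thesis
    proof (rule fekete)
      show "ln (Z (m + n)) \<le> ln (Z m) + ln (Z n)" for m n
        using word_weight_sum_submult[OF True] Z
        by (simp add: Z_def flip: ln_mult_pos)
      show "ln a * real n \<le> ln (Z n)" for n
        using word_weight_sum_ge[OF True] Z a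
        by (simp add: Z_def a_def mult.commute flip: ln_realpow)
    qed
  next
    case False
    then have le: "t1 + t2 \<le> s" by simp
    \<comment> \<open>A supermultiplicative sequence becomes subadditive after taking
      \<open>- ln\<close>; the upper bound on \<open>Z\<close> provides the linear lower
      bound.\<close>
    have "convergent (\<lambda>k. - ln (Z k) / real k)"
    proof (rule fekete)
      show "- ln (Z (m + n)) \<le> - ln (Z m) + - ln (Z n)" for m n
      proof -
        have "ln (Z m) + ln (Z n) \<le> ln (Z (m + n))"
          using word_weight_sum_supermult[OF le] Z
          by (simp add: Z_def flip: ln_mult_pos)
        then show ?thesis by simp
      qed
      have "ln (Z n) \<le> real n * ln a" for n
        using word_weight_sum_le[OF le] Z a
        by (simp add: Z_def a_def flip: ln_realpow)
      then show "- ln a * real n \<le> - ln (Z n)" for n by (simp add: mult.commute)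
    qed
    then show ?thesis by (subst convergent_minus_iff) simp
  qed
  then show ?thesis unfolding log_pressure_def Z_def by (simp add: convergent_LIMSEQ_iff)
qed

section \<open>Dependence of the logarithmic pressure on \<open>s\<close>\<close>

lemma sum_list_bounds:
  assumes "w \<in> words I k" "\<And>i. i \<in> I \<Longrightarrow> b1 \<le> l i \<and> l i \<le> b2"
  shows "real k * b1 \<le> (\<Sum>i\<leftarrow>w. l i) \<and> (\<Sum>i\<leftarrow>w. l i) \<le> real k * (b2::real)"
  using assms(1)
proof (induction w arbitrary: k)
  case (Cons i w)
  then have "i \<in> I" "w \<in> words I (length w)" "k = Suc (length w)" by (auto simp: words_def)
  then show ?case using Cons.IH[of "length w"] assms(2)[of i] by (simp add: algebra_simps)
qed (simp add: words_def)

lemma log_contraction_bounds: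
  obtains b1 b2 where "b1 > 0"
    "\<And>i. i \<in> I \<Longrightarrow> b1 \<le> - ln (c i) \<and> - ln (c i) \<le> b2"
    "\<And>i. i \<in> I \<Longrightarrow> b1 \<le> - ln (d i) \<and> - ln (d i) \<le> b2"
proof
  let ?S = "(\<lambda>i. - ln (c i)) ` I \<union> (\<lambda>i. - ln (d i)) ` I"
  have fin: "finite ?S" "?S \<noteq> {}" using finite_I I_nonempty by auto
  show "Min ?S > 0" using fin c_range d_range by (subst Min_gr_iff) auto
  show "Min ?S \<le> - ln (c i) \<and> - ln (c i) \<le> Max ?S" if "i \<in> I" for i
    using fin that by (auto intro!: Min_le Max_ge)
  show "Min ?S \<le> - ln (d i) \<and> - ln (d i) \<le> Max ?S" if "i \<in> I" for i
    using fin that by (auto intro!: Min_le Max_ge)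
qed

text \<open>In either branch, \<open>s\<close> occurs only in the exponent of the smaller of the two
  contraction products.\<close>

lemma word_weight_shift:
  assumes "w \<in> words I k"
  shows "word_weight c d p q t1 t2 s' w = word_weight c d p q t1 t2 s w
    * exp ((s' - s) * ln (min (word_prod c w) (word_prod d w)))"
  using word_prod_pos_system[OF assms]
  by (simp add: word_weight_def word_prod_letter_weight[OF assms] powr_def min_def
      weighted_system.word_prod_letter_weight[OF swapped assms] flip: exp_add)
    (auto simp: algebra_simps)

text \<open>The logarithm of the smaller contraction product of a word of length \<open>k\<close>
  lies between \<open>- k * b2\<close> and \<open>- k * b1\<close>. Positivity of \<open>b1\<close>
  gives strict decrease in \<open>s\<close>, hence a unique root; \<open>b2\<close> gives
  continuity.\<close>

lemma log_pressure_bilipschitz: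
  obtains b1 b2 where "b1 > 0"
    "\<And>s s'. s \<le> s' \<Longrightarrow>
      b1 * (s' - s) \<le> log_pressure I c d p q t1 t2 s - log_pressure I c d p q t1 t2 s'
      \<and> log_pressure I c d p q t1 t2 s - log_pressure I c d p q t1 t2 s' \<le> b2 * (s' - s)"
proof -
  obtain b1 b2 where b1: "b1 > 0"
    and bc: "\<And>i. i \<in> I \<Longrightarrow> b1 \<le> - ln (c i) \<and> - ln (c i) \<le> b2"
    and bd: "\<And>i. i \<in> I \<Longrightarrow> b1 \<le> - ln (d i) \<and> - ln (d i) \<le> b2"
    using log_contraction_bounds by blast
  have shift: "b1 * (s' - s) \<le> log_pressure I c d p q t1 t2 s - log_pressure I c d p q t1 t2 s'
      \<and> log_pressure I c d p q t1 t2 s - log_pressure I c d p q t1 t2 s' \<le> b2 * (s' - s)"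
    if ss: "s \<le> s'" for s s'
  proof -
    define Z where "Z = (\<lambda>s. word_weight_sum I c d p q t1 t2 s)"
    have Zpos: "Z s k > 0" for s k unfolding Z_def by (rule word_weight_sum_pos)
    have Z: "Z s k * exp (- (real k * (b2 * (s' - s)))) \<le> Z s' k
        \<and> Z s' k \<le> Z s k * exp (- (real k * (b1 * (s' - s))))" for k
    proof -
      have w: "- (real k * b2) \<le> ln (min (word_prod c w) (word_prod d w))
          \<and> ln (min (word_prod c w) (word_prod d w)) \<le> - (real k * b1)" if w: "w \<in> words I k" for w
      proof -
        have "ln (word_prod c w) = (\<Sum>i\<leftarrow>w. ln (c i))" "ln (word_prod d w) = (\<Sum>i\<leftarrow>w. ln (d i))"
          using ln_word_prod[OF _ w] c_range d_range by auto
        moreover have "real k * - b2 \<le> (\<Sum>i\<leftarrow>w. ln (c i)) \<and> (\<Sum>i\<leftarrow>w. ln (c i)) \<le> real k * - b1"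
          using bc by (intro sum_list_bounds[OF w]) force
        moreover have "real k * - b2 \<le> (\<Sum>i\<leftarrow>w. ln (d i)) \<and> (\<Sum>i\<leftarrow>w. ln (d i)) \<le> real k * - b1"
          using bd by (intro sum_list_bounds[OF w]) force
        ultimately show ?thesis by (simp add: min_def)
      qed
      have w': "- (real k * (b2 * (s' - s))) \<le> (s' - s) * ln (min (word_prod c w) (word_prod d w))
          \<and> (s' - s) * ln (min (word_prod c w) (word_prod d w)) \<le> - (real k * (b1 * (s' - s)))"
        if "w \<in> words I k" for w
      proof -
        have "(s' - s) * - (real k * b2) \<le> (s' - s) * ln (min (word_prod c w) (word_prod d w))"
          "(s' - s) * ln (min (word_prod c w) (word_prod d w)) \<le> (s' - s) * - (real k * b1)"
          using w[OF that] ss by (intro mult_left_mono; simp)+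
        then show ?thesis by (simp add: ac_simps)
      qed
      show ?thesis
        unfolding Z_def word_weight_sum_def sum_distrib_right
        by (intro conjI sum_mono; subst word_weight_shift[of _ k _ _ _ s' s])
          (use w' word_weight_pos in \<open>auto intro!: mult_left_mono less_imp_le\<close>)
    qed
    have lim: "(\<lambda>k. ln (Z s k) / real k - ln (Z s' k) / real k)
        \<longlonglongrightarrow> log_pressure I c d p q t1 t2 s - log_pressure I c d p q t1 t2 s'"
      unfolding Z_def by (intro tendsto_diff tendsto_log_pressure)
    have ln: "b1 * (s' - s) \<le> ln (Z s k) / real k - ln (Z s' k) / real k
        \<and> ln (Z s k) / real k - ln (Z s' k) / real k \<le> b2 * (s' - s)" if "k \<ge> 1" for k
    proof -
      have "ln (Z s k * exp (- (real k * (b2 * (s' - s))))) \<le> ln (Z s' k)"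
        "ln (Z s' k) \<le> ln (Z s k * exp (- (real k * (b1 * (s' - s)))))"
        using Z Zpos by (auto intro!: ln_mono)
      then have "real k * (b1 * (s' - s)) \<le> ln (Z s k) - ln (Z s' k)"
        "ln (Z s k) - ln (Z s' k) \<le> real k * (b2 * (s' - s))"
        using Zpos[of s k] by (simp_all add: ln_mult_pos)
      with that show ?thesis
        by (simp add: diff_divide_distrib[symmetric] field_simps)
    qed
    show ?thesis
    proof
      show "b1 * (s' - s) \<le> log_pressure I c d p q t1 t2 s - log_pressure I c d p q t1 t2 s'"
        by (rule LIMSEQ_le_const[OF lim]) (use ln in blast)
      show "log_pressure I c d p q t1 t2 s - log_pressure I c d p q t1 t2 s' \<le> b2 * (s' - s)"
        by (rule LIMSEQ_le_const2[OF lim]) (use ln in blast)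
    qed
  qed
  show ?thesis by (rule that[OF b1 shift])
qed

section \<open>Upper and lower bounds for the logarithmic pressure\<close>

text \<open>Above \<open>t1 + t2\<close> the word weight is at most the first multiplicative weight;
  otherwise it is at most the sum of both. In either case the sums over words stay below 2, a
  constant that disappears after taking logarithms and dividing by \<open>k\<close>.\<close>

lemma log_pressure_nonpos:
  assumes "(\<Sum>i\<in>I. letter_weight c d p q t1 s i) \<le> 1"
    and "s \<le> t1 + t2 \<Longrightarrow> (\<Sum>i\<in>I. letter_weight d c p q t2 s i) \<le> 1"
  shows "log_pressure I c d p q t1 t2 s \<le> 0"
proof -
  define Z where "Z = word_weight_sum I c d p q t1 t2 s"
  have a: "(\<Sum>i\<in>I. letter_weight c d p q t1 s i) ^ k \<le> 1" for k
    using assms(1) letter_weight_sum_pos[of q t1 s] by (intro power_le_one) auto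
  have Z: "Z k \<le> 2" for k
  proof (cases "s \<le> t1 + t2")
    case True
    then have "(\<Sum>i\<in>I. letter_weight d c p q t2 s i) ^ k \<le> 1"
      using assms(2) weighted_system.letter_weight_sum_pos[OF swapped, of q t2 s]
      by (intro power_le_one) auto
    then show ?thesis unfolding Z_def
      using word_weight_sum_le_add[of q t1 t2 s k] a[of k] by linarith
  next
    case False
    then show ?thesis unfolding Z_def
      using word_weight_sum_le[of t1 t2 s q k] a[of k] by linarith
  qed
  have "ln (Z k) / real k \<le> ln 2 / real k" for k
    using Z[of k] word_weight_sum_pos[of q t1 t2 s k] unfolding Z_def
    by (intro divide_right_mono) auto
  moreover have "(\<lambda>k. ln 2 / real k) \<longlonglongrightarrow> 0" by (rule lim_const_over_n)
  ultimately show ?thesis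
    using LIMSEQ_le[OF tendsto_log_pressure, of "\<lambda>k. ln 2 / real k" 0] unfolding Z_def by blast
qed

text \<open>Jensen's inequality for the exponential reduces the bound to the mean of the logarithm of
  the word weight. The words with \<open>d\<^sub>w > c\<^sub>w\<close> contribute an error bounded by the positive part of
  \<open>ln (d\<^sub>w / c\<^sub>w)\<close>, a random walk with nonpositive drift, whose mean is \<open>O(sqrt k)\<close>.\<close>

lemma log_pressure_ge:
  assumes drift: "mean_neg_log I p c \<le> mean_neg_log I p d"
  shows "- ((q - 1) * mean_neg_log I p p + t1 * mean_neg_log I p c + (s - t1) * mean_neg_log I p d)
     \<le> log_pressure I c d p q t1 t2 s"
proof -
  define x where "x i = (q - 1) * ln (p i) + t1 * ln (c i) + (s - t1) * ln (d i)" for i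
  define m where "m = (\<Sum>i\<in>I. p i * (ln (d i) - ln (c i)))"
  define l where "l i = ln (d i) - ln (c i) - m" for i
  define v where "v = (\<Sum>i\<in>I. p i * (l i)\<^sup>2)"
  define u where "u = t1 + t2 - s"
  define X where "X = (\<Sum>i\<in>I. p i * x i)"
  define Z where "Z = word_weight_sum I c d p q t1 t2 s"
  have X: "X = - ((q - 1) * mean_neg_log I p p + t1 * mean_neg_log I p c + (s - t1) * mean_neg_log I p d)"
    unfolding X_def x_def mean_neg_log_def
    by (simp add: sum_distrib_left algebra_simps sum.distrib sum_negf sum_subtractf)
  have m: "m \<le> 0"
    using drift unfolding m_def mean_neg_log_def by (simp add: sum_negf algebra_simps sum_subtractf)
  have l0: "(\<Sum>i\<in>I. p i * l i) = 0"
  proof -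
    have "(\<Sum>i\<in>I. p i * l i) = m - (\<Sum>i\<in>I. p i) * m"
      unfolding l_def m_def[symmetric] sum_distrib_right
      by (subst m_def) (simp add: algebra_simps sum_subtractf sum.distrib)
    then show ?thesis by (simp add: p_sum)
  qed
  have bound: "X - \<bar>u\<bar> * ((v + 1) / 2 / sqrt (real k)) \<le> ln (Z k) / real k" if k: "k \<ge> 1" for k
  proof -
    \<comment> \<open>A quadratic majorant of the centred sum, from the inequality of arithmetic and
      geometric means. Its mean needs only the variance and equals
      \<open>(v + 1) / 2 * sqrt k\<close>.\<close>
    define R where "R w = ((\<Sum>i\<leftarrow>w. l i)\<^sup>2 / sqrt (real k) + sqrt (real k)) / 2" for w
    define Y where "Y w = (\<Sum>i\<leftarrow>w. x i) - \<bar>u\<bar> * R w" for w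
    define y where "y = (\<Sum>w\<in>words I k. word_prod p w * Y w)"
    have sk: "sqrt (real k) > 0" using k by simp
    have one: "(\<Sum>w\<in>words I k. word_prod p w) = 1" by (simp add: sum_words_word_prod p_sum)
    have y: "y = real k * X - \<bar>u\<bar> * ((real k * v / sqrt (real k) + sqrt (real k)) / 2)"
    proof -
      have "y = (\<Sum>w\<in>words I k. word_prod p w * (\<Sum>i\<leftarrow>w. x i))
          - \<bar>u\<bar> * (((\<Sum>w\<in>words I k. word_prod p w * (\<Sum>i\<leftarrow>w. l i)\<^sup>2) / sqrt (real k)
             + (\<Sum>w\<in>words I k. word_prod p w) * sqrt (real k)) / 2)"
        unfolding y_def Y_def R_def
        by (simp add: sum_distrib_left sum_distrib_right sum_divide_distrib algebra_simps
            sum_subtractf sum.distrib add_divide_distrib)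
      then show ?thesis by (simp add: sum_additive sum_centred_square[OF l0] one X_def v_def)
    qed
    have weight: "word_prod p w * exp (Y w) \<le> word_weight c d p q t1 t2 s w"
      if w: "w \<in> words I k" for w
    proof -
      let ?P = "word_prod p w" and ?C = "word_prod c w" and ?D = "word_prod d w"
      note pos = word_prod_pos_system[OF w]
      have lns: "ln ?P = (\<Sum>i\<leftarrow>w. ln (p i))" "ln ?C = (\<Sum>i\<leftarrow>w. ln (c i))"
        "ln ?D = (\<Sum>i\<leftarrow>w. ln (d i))"
        using ln_word_prod[OF _ w] c_range d_range p_range by auto
      have xs: "(\<Sum>i\<leftarrow>w. x i) = (q - 1) * ln ?P + t1 * ln ?C + (s - t1) * ln ?D"
        unfolding lns x_def by (simp add: sum_list_addf sum_list_const_mult)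
      have A: "word_prod (letter_weight c d p q t1 s) w = ?P * exp (\<Sum>i\<leftarrow>w. x i)"
        unfolding word_prod_letter_weight[OF w] xs using pos
        by (simp add: powr_def exp_add left_diff_distrib exp_diff)
      have R0: "R w \<ge> 0" unfolding R_def by simp
      show ?thesis
      proof (cases "?D \<le> ?C")
        case True
        then show ?thesis using pos R0 by (simp add: word_weight_def A Y_def)
      next
        case False
        define L where "L = ln ?D - ln ?C"
        have L0: "L > 0" using False pos by (simp add: L_def)
        have "length w = k" using w by (simp add: words_def)
        then have "(\<Sum>i\<leftarrow>w. l i) = L - real k * m"
          unfolding l_def L_def lns by (simp add: sum_list_subtractf sum_list_triv)
        \<comment> \<open>The drift condition enters here: removing a nonpositive drift can only
          increase the sum.\<close>
        moreover have "real k * m \<le> 0" using m by (simp add: mult_nonneg_nonpos)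
        ultimately have "L \<le> (\<Sum>i\<leftarrow>w. l i)" by linarith
        also have "\<dots> \<le> R w"
        proof -
          have "0 \<le> ((\<Sum>i\<leftarrow>w. l i) - sqrt (real k))\<^sup>2 / (2 * sqrt (real k))" using sk by simp
          also have "\<dots> = R w - (\<Sum>i\<leftarrow>w. l i)"
            unfolding R_def using sk by (simp add: field_simps power2_diff)
          finally show ?thesis by simp
        qed
        finally have "\<bar>u\<bar> * L \<le> \<bar>u\<bar> * R w" by (intro mult_left_mono) auto
        moreover have "- (u * L) \<le> \<bar>u\<bar> * L"
          using L0 mult_right_mono[of "- u" "\<bar>u\<bar>" L] by simp
        ultimately have "Y w \<le> (\<Sum>i\<leftarrow>w. x i) + u * L" unfolding Y_def by linarith
        then have "?P * exp (Y w) \<le> ?P * (exp (\<Sum>i\<leftarrow>w. x i) * exp (u * L))"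
          using pos by (simp add: exp_add[symmetric])
        also have "exp (u * L) = (?D / ?C) powr u"
          using pos by (simp add: powr_def L_def ln_div)
        finally show ?thesis
          using False by (simp add: word_weight_def A word_prod_swapped_letter_weight[OF w, of q t2 s t1] u_def)
      qed
    qed
    \<comment> \<open>Jensen's inequality through the tangent line of \<open>exp\<close> at the mean
      \<open>y\<close> of \<open>Y\<close>, whose linear part averages to zero.\<close>
    have "exp y = (\<Sum>w\<in>words I k. word_prod p w * (exp y * (1 + (Y w - y))))"
    proof -
      have "(\<Sum>w\<in>words I k. word_prod p w * (exp y * (1 + (Y w - y))))
          = exp y * ((\<Sum>w\<in>words I k. word_prod p w) * (1 - y) + (\<Sum>w\<in>words I k. word_prod p w * Y w))"
        unfolding sum_distrib_left sum_distrib_right sum.distrib[symmetric]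
        by (intro sum.cong refl) (simp add: algebra_simps)
      also have "(\<Sum>w\<in>words I k. word_prod p w * Y w) = y" by (simp add: y_def)
      finally have "(\<Sum>w\<in>words I k. word_prod p w * (exp y * (1 + (Y w - y))))
          = exp y * ((\<Sum>w\<in>words I k. word_prod p w) * (1 - y) + y)" .
      then show ?thesis by (simp add: one)
    qed
    also have "\<dots> \<le> (\<Sum>w\<in>words I k. word_prod p w * exp (Y w))"
    proof (intro sum_mono mult_left_mono)
      fix w assume w: "w \<in> words I k"
      have "exp y * (1 + (Y w - y)) \<le> exp y * exp (Y w - y)"
        by (intro mult_left_mono exp_ge_add_one_self) auto
      then show "exp y * (1 + (Y w - y)) \<le> exp (Y w)" by (simp flip: exp_add)
      show "0 \<le> word_prod p w" using word_prod_pos_system(1)[OF w] by simp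
    qed
    also have "\<dots> \<le> Z k"
      unfolding Z_def word_weight_sum_def by (intro sum_mono weight)
    finally have "y \<le> ln (Z k)"
      using word_weight_sum_pos[of q t1 t2 s k] by (simp add: Z_def ln_ge_iff)
    then have "y / real k \<le> ln (Z k) / real k" by (intro divide_right_mono) auto
    moreover have "y / real k = X - \<bar>u\<bar> * ((v + 1) / 2 / sqrt (real k))"
    proof -
      define r where "r = sqrt (real k)"
      have r: "r > 0" "real k = r * r" using k by (simp_all add: r_def)
      show ?thesis
        unfolding y r_def[symmetric] unfolding r(2) using r(1) by (simp add: field_simps)
    qed
    ultimately show ?thesis by simp
  qed
  have lim: "(\<lambda>k. X - \<bar>u\<bar> * ((v + 1) / 2 / sqrt (real k))) \<longlonglongrightarrow> X - \<bar>u\<bar> * 0"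
    by (intro tendsto_intros real_tendsto_divide_at_top[OF tendsto_const]
        filterlim_compose[OF sqrt_at_top] filterlim_real_sequentially)
  have "X - \<bar>u\<bar> * 0 \<le> log_pressure I c d p q t1 t2 s"
    by (rule LIMSEQ_le[OF lim tendsto_log_pressure]) (use bound in \<open>auto simp: Z_def\<close>)
  then show ?thesis by (simp add: X)
qed

section \<open>Second-order estimates near \<open>q = 1\<close>\<close>

lemma mean_neg_log_weight_exponent:
  "(\<Sum>i\<in>I. p i * ((q - 1) * ln (p i) + t * ln (c i) + (s - t) * ln (d i)))
    = mean_neg_log I p d * (root_tangent I c d p q t - s)"
proof -
  have "(\<Sum>i\<in>I. p i * ((q - 1) * ln (p i) + t * ln (c i) + (s - t) * ln (d i)))
    = - ((q - 1) * mean_neg_log I p p + t * mean_neg_log I p c + (s - t) * mean_neg_log I p d)"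
    unfolding mean_neg_log_def
    by (simp add: sum_distrib_left algebra_simps sum.distrib sum_negf sum_subtractf)
  also have "\<dots> = mean_neg_log I p d * (root_tangent I c d p q t - s)"
    using mean_neg_log_pos(2) unfolding root_tangent_def by (simp add: field_simps)
  finally show ?thesis .
qed

text \<open>The tangent line bounds \<open>exp\<close> from below; at
  \<open>s = root_tangent I c d p q t\<close> the linear term vanishes, so the sum is at least 1
  there.\<close>

lemma letter_weight_sum_lower:
  "1 + mean_neg_log I p d * (root_tangent I c d p q t - s) \<le> (\<Sum>i\<in>I. letter_weight c d p q t s i)"
proof -
  let ?x = "\<lambda>i. (q - 1) * ln (p i) + t * ln (c i) + (s - t) * ln (d i)"
  have "1 + mean_neg_log I p d * (root_tangent I c d p q t - s) = (\<Sum>i\<in>I. p i * (1 + ?x i))"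
    by (simp add: mean_neg_log_weight_exponent[symmetric] distrib_left sum.distrib p_sum)
  also have "\<dots> \<le> (\<Sum>i\<in>I. p i * exp (?x i))"
    using p_range by (intro sum_mono mult_left_mono exp_ge_add_one_self) (auto intro: less_imp_le)
  finally show ?thesis by (simp add: letter_weight_eq_exp)
qed

lemma letter_weight_sum_upper:
  assumes "\<And>i. i \<in> I \<Longrightarrow> \<bar>(q - 1) * ln (p i) + t * ln (c i) + (s - t) * ln (d i)\<bar> \<le> e" "e \<le> 1"
  shows "(\<Sum>i\<in>I. letter_weight c d p q t s i)
    \<le> 1 + mean_neg_log I p d * (root_tangent I c d p q t - s) + e\<^sup>2"
proof -
  let ?x = "\<lambda>i. (q - 1) * ln (p i) + t * ln (c i) + (s - t) * ln (d i)"
  have "(\<Sum>i\<in>I. p i * exp (?x i)) \<le> (\<Sum>i\<in>I. p i * (1 + ?x i + e\<^sup>2))"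
  proof (intro sum_mono mult_left_mono)
    fix i assume i: "i \<in> I"
    have "exp (?x i) \<le> 1 + ?x i + (?x i)\<^sup>2"
      using assms(1)[OF i] assms(2) by (intro exp_le_quadratic) linarith
    moreover have "(?x i)\<^sup>2 \<le> e\<^sup>2"
      using assms(1)[OF i] by (simp add: power2_le_iff_abs_le)
    ultimately show "exp (?x i) \<le> 1 + ?x i + e\<^sup>2" by linarith
    show "0 \<le> p i" using p_range[OF i] by simp
  qed
  also have "\<dots> = 1 + mean_neg_log I p d * (root_tangent I c d p q t - s) + e\<^sup>2"
    by (simp add: mean_neg_log_weight_exponent[symmetric] distrib_left sum.distrib p_sum
        flip: sum_distrib_right)
  finally show ?thesis by (simp add: letter_weight_eq_exp)
qed

lemma log_bound:
  obtains \<Lambda> where "\<Lambda> \<ge> 0" "\<And>i. i \<in> I \<Longrightarrow> \<bar>ln (p i)\<bar> \<le> \<Lambda> \<and> \<bar>ln (c i)\<bar> \<le> \<Lambda> \<and> \<bar>ln (d i)\<bar> \<le> \<Lambda>"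
proof
  let ?f = "\<lambda>i. \<bar>ln (p i)\<bar> + \<bar>ln (c i)\<bar> + \<bar>ln (d i)\<bar>"
  show "sum ?f I \<ge> 0" by (intro sum_nonneg) auto
  fix i assume "i \<in> I"
  then have "?f i \<le> sum ?f I" using finite_I by (intro member_le_sum) auto
  then show "\<bar>ln (p i)\<bar> \<le> sum ?f I \<and> \<bar>ln (c i)\<bar> \<le> sum ?f I \<and> \<bar>ln (d i)\<bar> \<le> sum ?f I"
    by linarith
qed

text \<open>Raising \<open>s\<close> above the tangent by \<open>M * (q - 1)^2\<close> produces a
  negative linear term that absorbs the second-order error in
  \<open>letter_weight_sum_upper\<close>. The quantified \<open>s\<close> merely abbreviates this
  raised value.\<close>

lemma letter_weight_sums_le_1:
  assumes K: "K \<ge> 0" "\<forall>\<^sub>F q in nhds 1. \<bar>T1 q\<bar> \<le> K * \<bar>q - 1\<bar>" "\<forall>\<^sub>F q in nhds 1. \<bar>T2 q\<bar> \<le> K * \<bar>q - 1\<bar>"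
  obtains M where "M \<ge> 0" "\<forall>\<^sub>F q in nhds 1. \<forall>s. s = root_tangent I c d p q (T1 q) + M * (q - 1)\<^sup>2 \<longrightarrow>
      (\<Sum>i\<in>I. letter_weight c d p q (T1 q) s i) \<le> 1
      \<and> (mean_neg_log I p c \<le> mean_neg_log I p d \<longrightarrow> s \<le> T1 q + T2 q \<longrightarrow>
          (\<Sum>i\<in>I. letter_weight d c p q (T2 q) s i) \<le> 1)"
proof -
  obtain \<Lambda> where \<Lambda>: "\<Lambda> \<ge> 0"
    "\<And>i. i \<in> I \<Longrightarrow> \<bar>ln (p i)\<bar> \<le> \<Lambda> \<and> \<bar>ln (c i)\<bar> \<le> \<Lambda> \<and> \<bar>ln (d i)\<bar> \<le> \<Lambda>"
    using log_bound by blast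
  define h x y where "h = mean_neg_log I p p" and "x = mean_neg_log I p c" and "y = mean_neg_log I p d"
  have xy: "x > 0" "y > 0" unfolding x_def y_def by (rule mean_neg_log_pos)+
  \<comment> \<open>Relative to \<open>\<bar>q - 1\<bar>\<close>, \<open>K'\<close> bounds the
    tangent and \<open>Q\<close> bounds every exponent in the letter weights; \<open>M\<close> is
    then chosen so that \<open>y * M = Q^2\<close>.\<close>
  define K' where "K' = (\<bar>y - x\<bar> * K + \<bar>h\<bar>) / y"
  define Q where "Q = (2 + 2 * K + K') * \<Lambda>"
  define M where "M = Q\<^sup>2 / y"
  have K'0: "K' \<ge> 0" unfolding K'_def using xy K by simp
  have Q0: "Q \<ge> 0" unfolding Q_def using K K'0 \<Lambda> by simp
  have M0: "M \<ge> 0" unfolding M_def using xy by simp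
  \<comment> \<open>This radius makes the exponents at most 1, as \<open>exp_le_quadratic\<close>
    requires, and the correction \<open>M * (q - 1)^2\<close> at most
    \<open>\<bar>q - 1\<bar>\<close>.\<close>
  have "\<forall>\<^sub>F q in nhds (1::real). dist q 1 < 1 / (Q + M + 1)"
    using Q0 M0 by (intro eventually_nhds_metric[THEN iffD2] exI[of _ "1 / (Q + M + 1)"]) auto
  then have "\<forall>\<^sub>F q in nhds 1. \<forall>s. s = root_tangent I c d p q (T1 q) + M * (q - 1)\<^sup>2 \<longrightarrow>
      (\<Sum>i\<in>I. letter_weight c d p q (T1 q) s i) \<le> 1
      \<and> (mean_neg_log I p c \<le> mean_neg_log I p d \<longrightarrow> s \<le> T1 q + T2 q \<longrightarrow>
          (\<Sum>i\<in>I. letter_weight d c p q (T2 q) s i) \<le> 1)"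
    using K(2,3)
  proof (eventually_elim, intro allI impI)
    fix q s
    assume near: "dist q 1 < 1 / (Q + M + 1)"
      and T1: "\<bar>T1 q\<bar> \<le> K * \<bar>q - 1\<bar>" and T2: "\<bar>T2 q\<bar> \<le> K * \<bar>q - 1\<bar>"
      and s: "s = root_tangent I c d p q (T1 q) + M * (q - 1)\<^sup>2"
    define \<eta> where "\<eta> = \<bar>q - 1\<bar>"
    have \<eta>0: "\<eta> \<ge> 0" by (simp add: \<eta>_def)
    have "(Q + M + 1) * \<eta> \<le> 1"
      using near Q0 M0 by (simp add: dist_real_def \<eta>_def field_simps)
    then have "Q * \<eta> + M * \<eta> + \<eta> \<le> 1" by (simp add: algebra_simps)
    then have Q\<eta>: "Q * \<eta> \<le> 1" and M\<eta>: "M * \<eta> \<le> 1"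
      using \<eta>0 mult_nonneg_nonneg[OF Q0 \<eta>0] mult_nonneg_nonneg[OF M0 \<eta>0] by linarith+
    have "\<bar>(y - x) * T1 q - (q - 1) * h\<bar> \<le> \<bar>y - x\<bar> * (K * \<eta>) + \<eta> * \<bar>h\<bar>"
      using mult_left_mono[OF T1, of "\<bar>y - x\<bar>"] abs_triangle_ineq4[of "(y - x) * T1 q" "(q - 1) * h"]
      by (simp add: abs_mult \<eta>_def)
    then have "\<bar>root_tangent I c d p q (T1 q)\<bar> \<le> K' * \<eta>"
      using xy unfolding root_tangent_def K'_def h_def[symmetric] x_def[symmetric] y_def[symmetric]
      by (simp add: divide_simps) (simp add: algebra_simps)
    moreover have "\<bar>M * (q - 1)\<^sup>2\<bar> = (M * \<eta>) * \<eta>"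
      using M0 by (simp add: \<eta>_def power2_eq_square abs_mult)
    moreover have "(M * \<eta>) * \<eta> \<le> 1 * \<eta>" using M\<eta> \<eta>0 by (intro mult_right_mono)
    ultimately have s_bound: "\<bar>s\<bar> \<le> (K' + 1) * \<eta>"
      unfolding s by (simp add: algebra_simps)
    have exponent: "\<bar>(q - 1) * ln (p i) + t * a + (s - t) * b\<bar> \<le> Q * \<eta>"
      if "i \<in> I" "\<bar>t\<bar> \<le> K * \<bar>q - 1\<bar>" "\<bar>a\<bar> \<le> \<Lambda>" "\<bar>b\<bar> \<le> \<Lambda>" for i t a b
    proof -
      have "\<bar>s - t\<bar> \<le> (K' + 1) * \<eta> + K * \<eta>" using s_bound that(2) unfolding \<eta>_def by linarith
      then have "\<bar>(s - t) * b\<bar> \<le> ((K' + 1) * \<eta> + K * \<eta>) * \<Lambda>"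
        unfolding abs_mult using that(4) by (intro mult_mono) auto
      moreover have "\<bar>t * a\<bar> \<le> (K * \<eta>) * \<Lambda>"
        unfolding abs_mult using that(2,3) by (intro mult_mono) (auto simp: \<eta>_def)
      moreover have "\<bar>(q - 1) * ln (p i)\<bar> \<le> \<eta> * \<Lambda>"
        unfolding abs_mult using \<Lambda>(2)[OF that(1)] by (intro mult_mono) (auto simp: \<eta>_def)
      moreover have "Q * \<eta> = \<eta> * \<Lambda> + (K * \<eta>) * \<Lambda> + ((K' + 1) * \<eta> + K * \<eta>) * \<Lambda>"
        unfolding Q_def by (simp add: algebra_simps)
      ultimately show ?thesis by linarith
    qed
    have yM: "y * (root_tangent I c d p q (T1 q) - s) + (Q * \<eta>)\<^sup>2 = 0"
      using xy unfolding s M_def \<eta>_def by (simp add: power_mult_distrib)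
    show "(\<Sum>i\<in>I. letter_weight c d p q (T1 q) s i) \<le> 1
      \<and> (mean_neg_log I p c \<le> mean_neg_log I p d \<longrightarrow> s \<le> T1 q + T2 q \<longrightarrow>
          (\<Sum>i\<in>I. letter_weight d c p q (T2 q) s i) \<le> 1)"
    proof (intro conjI impI)
      have "(\<Sum>i\<in>I. letter_weight c d p q (T1 q) s i)
          \<le> 1 + y * (root_tangent I c d p q (T1 q) - s) + (Q * \<eta>)\<^sup>2"
        unfolding y_def using exponent T1 \<Lambda>(2) by (intro letter_weight_sum_upper Q\<eta>) blast
      then show "(\<Sum>i\<in>I. letter_weight c d p q (T1 q) s i) \<le> 1" using yM by linarith
    next
      assume drift: "mean_neg_log I p c \<le> mean_neg_log I p d" and u: "s \<le> T1 q + T2 q"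
      have "(\<Sum>i\<in>I. letter_weight d c p q (T2 q) s i)
          \<le> 1 + x * (root_tangent I d c p q (T2 q) - s) + (Q * \<eta>)\<^sup>2"
        unfolding x_def using exponent T2 \<Lambda>(2)
        by (intro weighted_system.letter_weight_sum_upper[OF swapped] Q\<eta>) blast
      \<comment> \<open>The entropy terms cancel. What remains is nonnegative by the drift condition
        and \<open>s \<le> T1 q + T2 q\<close>, so the linear term of the second sum is at most that
        of the first.\<close>
      moreover have "y * (root_tangent I c d p q (T1 q) - s) - x * (root_tangent I d c p q (T2 q) - s)
          = (y - x) * (T1 q + T2 q - s)"
      proof -
        have "y * root_tangent I c d p q (T1 q) = (y - x) * T1 q - (q - 1) * h"
          "x * root_tangent I d c p q (T2 q) = (x - y) * T2 q - (q - 1) * h"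
          using xy unfolding root_tangent_def x_def[symmetric] y_def[symmetric] h_def[symmetric]
          by simp_all
        then show ?thesis unfolding right_diff_distrib by (simp add: algebra_simps)
      qed
      moreover have "0 \<le> (y - x) * (T1 q + T2 q - s)"
        using drift u by (simp add: x_def y_def)
      ultimately show "(\<Sum>i\<in>I. letter_weight d c p q (T2 q) s i) \<le> 1" using yM by linarith
    qed
  qed
  with M0 show ?thesis by (rule that)
qed

section \<open>Derivatives of the roots at \<open>q = 1\<close>\<close>

lemma DERIV_root_tangent:
  assumes "(T has_real_derivative D) (at 1)"
  shows "((\<lambda>q. root_tangent I c d p q (T q)) has_real_derivative
    ((mean_neg_log I p d - mean_neg_log I p c) * D - mean_neg_log I p p) / mean_neg_log I p d) (at 1)"
  unfolding root_tangent_def using mean_neg_log_pos(2)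
  by (auto intro!: derivative_eq_intros assms)

lemma DERIV_letter_weight_root:
  assumes T: "(T has_real_derivative D) (at 1)" "T 1 = 0"
  shows "((\<lambda>q. THE s. (\<Sum>i\<in>I. letter_weight c d p q (T q) s i) = 1) has_real_derivative
    ((mean_neg_log I p d - mean_neg_log I p c) * D - mean_neg_log I p p) / mean_neg_log I p d) (at 1)"
proof -
  note bound = DERIV_zero_eventually_linear_bound[OF T]
  obtain M where M: "M \<ge> 0" "\<forall>\<^sub>F q in nhds 1. \<forall>s. s = root_tangent I c d p q (T q) + M * (q - 1)\<^sup>2 \<longrightarrow>
      (\<Sum>i\<in>I. letter_weight c d p q (T q) s i) \<le> 1
      \<and> (mean_neg_log I p c \<le> mean_neg_log I p d \<longrightarrow> s \<le> T q + T q \<longrightarrow>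
          (\<Sum>i\<in>I. letter_weight d c p q (T q) s i) \<le> 1)"
    using letter_weight_sums_le_1[OF _ bound bound] by auto
  from M(2) have "\<forall>\<^sub>F q in nhds 1.
      root_tangent I c d p q (T q) \<le> (THE s. (\<Sum>i\<in>I. letter_weight c d p q (T q) s i) = 1)
      \<and> (THE s. (\<Sum>i\<in>I. letter_weight c d p q (T q) s i) = 1) \<le> root_tangent I c d p q (T q) + M * (q - 1)\<^sup>2"
  proof eventually_elim
    case (elim q)
    show ?case
    proof (rule the_root_between)
      show "continuous_on UNIV (\<lambda>s. \<Sum>i\<in>I. letter_weight c d p q (T q) s i)"
        unfolding letter_weight_def using d_range
        by (intro continuous_intros ballI) force
      show "(\<Sum>i\<in>I. letter_weight c d p q (T q) s' i) < (\<Sum>i\<in>I. letter_weight c d p q (T q) s i)"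
        if "s < s'" for s s'
      proof (intro sum_strict_mono finite_I I_nonempty)
        fix i assume i: "i \<in> I"
        have "d i powr (s' - T q) < d i powr (s - T q)"
          using that d_range[OF i] by (intro powr_less_mono') auto
        then show "letter_weight c d p q (T q) s' i < letter_weight c d p q (T q) s i"
          unfolding letter_weight_def using c_range[OF i] p_range[OF i]
          by (intro mult_strict_left_mono) auto
      qed
      show "1 \<le> (\<Sum>i\<in>I. letter_weight c d p q (T q) (root_tangent I c d p q (T q)) i)"
        using letter_weight_sum_lower[of q "T q" "root_tangent I c d p q (T q)"] by simp
    qed (use M(1) elim in auto)
  qed
  then show ?thesis by (rule DERIV_quadratic_sandwich[OF DERIV_root_tangent[OF T(1)]])
qed

text \<open>\<open>log_pressure_ge\<close> places the root above the tangent, and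
  \<open>log_pressure_nonpos\<close> places it below the tangent raised by
  \<open>M * (q - 1)^2\<close>. If the Lyapunov exponents coincide, the coefficient of
  \<open>D1\<close> is zero and the formula is symmetric in the coordinates.\<close>

lemma DERIV_log_pressure_root:
  assumes drift: "mean_neg_log I p c \<le> mean_neg_log I p d"
    and T1: "(T1 has_real_derivative D1) (at 1)" "T1 1 = 0"
    and T2: "(T2 has_real_derivative D2) (at 1)" "T2 1 = 0"
  shows "((\<lambda>q. THE s. log_pressure I c d p q (T1 q) (T2 q) s = 0) has_real_derivative
    ((mean_neg_log I p d - mean_neg_log I p c) * D1 - mean_neg_log I p p) / mean_neg_log I p d) (at 1)"
proof -
  define K where "K = max (\<bar>D1\<bar> + 1) (\<bar>D2\<bar> + 1)"
  have K: "K \<ge> 0" by (simp add: K_def)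
  have K1: "\<forall>\<^sub>F q in nhds 1. \<bar>T1 q\<bar> \<le> K * \<bar>q - 1\<bar>"
    using DERIV_zero_eventually_linear_bound[OF T1]
    by (auto simp: K_def elim!: eventually_mono order_trans intro!: mult_right_mono)
  have K2: "\<forall>\<^sub>F q in nhds 1. \<bar>T2 q\<bar> \<le> K * \<bar>q - 1\<bar>"
    using DERIV_zero_eventually_linear_bound[OF T2]
    by (auto simp: K_def elim!: eventually_mono order_trans intro!: mult_right_mono)
  obtain M where M: "M \<ge> 0" "\<forall>\<^sub>F q in nhds 1. \<forall>s. s = root_tangent I c d p q (T1 q) + M * (q - 1)\<^sup>2 \<longrightarrow>
      (\<Sum>i\<in>I. letter_weight c d p q (T1 q) s i) \<le> 1
      \<and> (mean_neg_log I p c \<le> mean_neg_log I p d \<longrightarrow> s \<le> T1 q + T2 q \<longrightarrow>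
          (\<Sum>i\<in>I. letter_weight d c p q (T2 q) s i) \<le> 1)"
    using letter_weight_sums_le_1[OF K K1 K2] by blast
  from M(2) have "\<forall>\<^sub>F q in nhds 1.
      root_tangent I c d p q (T1 q) \<le> (THE s. log_pressure I c d p q (T1 q) (T2 q) s = 0)
      \<and> (THE s. log_pressure I c d p q (T1 q) (T2 q) s = 0) \<le> root_tangent I c d p q (T1 q) + M * (q - 1)\<^sup>2"
  proof eventually_elim
    case (elim q)
    define f where "f = log_pressure I c d p q (T1 q) (T2 q)"
    obtain b1 b2 where b: "b1 > 0"
      "\<And>s s'. s \<le> s' \<Longrightarrow> b1 * (s' - s) \<le> f s - f s' \<and> f s - f s' \<le> b2 * (s' - s)"
      unfolding f_def using log_pressure_bilipschitz[of q "T1 q" "T2 q"] by blast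
    have decr: "f s' < f s" if "s < s'" for s s'
      using b(2)[of s s'] mult_pos_pos[OF b(1), of "s' - s"] that by linarith
    have "\<bar>f s - f s'\<bar> \<le> b2 * \<bar>s - s'\<bar>" for s s'
      using b(2)[of s s'] b(2)[of s' s] decr[of s s'] decr[of s' s]
      by (cases s s' rule: linorder_cases) auto
    moreover have "b2 \<ge> 0" using b(2)[of 0 1] b(1) by simp
    ultimately have "b2-lipschitz_on UNIV f"
      by (intro lipschitz_onI) (auto simp: dist_real_def)
    then have "continuous_on UNIV f" by (rule lipschitz_on_continuous_on)
    then have "root_tangent I c d p q (T1 q) \<le> (THE s. f s = 0)
        \<and> (THE s. f s = 0) \<le> root_tangent I c d p q (T1 q) + M * (q - 1)\<^sup>2"
    proof (rule the_root_between[OF _ decr])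
      show "0 \<le> f (root_tangent I c d p q (T1 q))"
        using log_pressure_ge[OF drift, of q "T1 q" "root_tangent I c d p q (T1 q)" "T2 q"]
          mean_neg_log_pos(2) unfolding f_def root_tangent_def by (simp add: field_simps)
      show "f (root_tangent I c d p q (T1 q) + M * (q - 1)\<^sup>2) \<le> 0"
        unfolding f_def using elim drift by (intro log_pressure_nonpos) auto
    qed (use M(1) in auto)
    then show ?case by (simp add: f_def)
  qed
  then show ?thesis by (rule DERIV_quadratic_sandwich[OF DERIV_root_tangent[OF T1(1)]])
qed

section \<open>Exchange of coordinates and the link to the pressure\<close>

text \<open>\<open>word_weight\<close> sends ties to its first branch, so its definition is not
  visibly symmetric; its description as a maximum or minimum is.\<close>

lemma log_pressure_swap: "log_pressure I c d p q t1 t2 s = log_pressure I d c p q t2 t1 s"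
proof -
  have "word_weight c d p q t1 t2 s w = word_weight d c p q t2 t1 s w" if "w \<in> words I k" for w k
  proof (cases "s \<le> t1 + t2")
    case True
    then show ?thesis
      using word_weight_eq_max[OF that] weighted_system.word_weight_eq_max[OF swapped that]
      by (simp add: add.commute max.commute)
  next
    case False
    then show ?thesis
      using word_weight_eq_min[OF that] weighted_system.word_weight_eq_min[OF swapped that]
      by (simp add: add.commute min.commute)
  qed
  then show ?thesis by (simp add: log_pressure_def word_weight_sum_def)
qed

lemma pressure_eq_exp:
  "pressure I c d p \<mu> s q = exp (log_pressure I c d p q (tau1 \<mu> q) (tau2 \<mu> q) s)"
proof -
  let ?Z = "word_weight_sum I c d p q (tau1 \<mu> q) (tau2 \<mu> q) s"
  have "psi c d p \<mu> s q w = word_weight c d p q (tau1 \<mu> q) (tau2 \<mu> q) s w"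
    if "w \<in> words I k" for w k
    by (simp add: psi_def word_weight_def tau_word_def alpha1_def alpha2_def
        word_prod_letter_weight[OF that] weighted_system.word_prod_letter_weight[OF swapped that])
  then have Psi: "Psi I c d p \<mu> s q k = ?Z k" for k
    by (simp add: Psi_def word_weight_sum_def)
  have "(\<lambda>k. exp (ln (?Z k) / real k)) \<longlonglongrightarrow> exp (log_pressure I c d p q (tau1 \<mu> q) (tau2 \<mu> q) s)"
    by (intro tendsto_exp tendsto_log_pressure)
  \<comment> \<open>The case \<open>k = 0\<close> is excluded: by default values the left side is 1
    there and the right side 0.\<close>
  moreover have "\<forall>\<^sub>F k in sequentially. exp (ln (?Z k) / real k) = root k (Psi I c d p \<mu> s q k)"
    using eventually_gt_at_top[of 0]
  proof eventually_elim
    case (elim k)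
    then show ?case
      using word_weight_sum_pos[of q "tau1 \<mu> q" "tau2 \<mu> q" s k]
      by (simp add: Psi root_powr_inverse powr_def)
  qed
  ultimately show ?thesis
    unfolding pressure_def by (intro limI) (rule Lim_transform_eventually)
qed

end

section \<open>The support of a measure and the spectrum at \<open>q = 1\<close>\<close>

text \<open>The complement of the support is the union of all open null sets; by the Lindelof
  property countably many of them suffice, so it is null.\<close>

lemma measure_support_measurable_AE:
  fixes \<nu> :: "'a::second_countable_topology measure"
  assumes "sets \<nu> = sets borel"
  shows "measure_support \<nu> \<in> sets \<nu>" "AE x in \<nu>. x \<in> measure_support \<nu>"
proof -
  define \<U> where "\<U> = {U. open U \<and> emeasure \<nu> U = 0}"
  have compl: "- measure_support \<nu> = \<Union>\<U>"
    by (auto simp: measure_support_def \<U>_def zero_less_iff_neq_zero)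
  then have "closed (measure_support \<nu>)"
    by (auto simp: closed_def \<U>_def)
  then show "measure_support \<nu> \<in> sets \<nu>" by (simp add: assms)
  obtain \<V> where \<V>: "\<V> \<subseteq> \<U>" "countable \<V>" "\<Union>\<V> = \<Union>\<U>"
    using Lindelof[of \<U>] by (auto simp: \<U>_def)
  have "U \<in> null_sets \<nu>" if "U \<in> \<V>" for U
    using that \<V>(1) by (auto simp: \<U>_def null_sets_def assms)
  then have "\<Union>\<V> \<in> null_sets \<nu>" using \<V>(2) null_sets_UN'[of \<V> id \<nu>] by simp
  then show "AE x in \<nu>. x \<in> measure_support \<nu>"
    using compl \<V>(3) by (intro AE_I'[of "\<Union>\<V>"]) auto
qed

lemma Lq_spectrum_1:
  fixes \<nu> :: "'a::{metric_space, second_countable_topology} measure"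
  assumes "prob_space \<nu>" "sets \<nu> = sets borel"
  shows "Lq_spectrum \<nu> 1 = 0"
proof -
  interpret prob_space \<nu> by fact
  note supp = measure_support_measurable_AE[OF assms(2)]
  have "(LINT x:measure_support \<nu>|\<nu>. measure \<nu> (cball x \<delta>) powr (1 - 1)) = 1" if "\<delta> > 0" for \<delta>
  proof -
    \<comment> \<open>Since \<open>0 powr 0 = 0\<close>, the ball must have positive measure, which
      holds at points of the support.\<close>
    have "measure \<nu> (cball x \<delta>) powr (1 - 1) = 1" if "x \<in> measure_support \<nu>" for x
    proof -
      have "0 < emeasure \<nu> (ball x \<delta>)"
        using that \<open>\<delta> > 0\<close> by (auto simp: measure_support_def)
      also have "\<dots> \<le> emeasure \<nu> (cball x \<delta>)"
        by (intro emeasure_mono ball_subset_cball) (simp add: assms(2))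
      finally show ?thesis by (simp add: emeasure_eq_measure)
    qed
    then have "(LINT x:measure_support \<nu>|\<nu>. measure \<nu> (cball x \<delta>) powr (1 - 1))
        = (LINT x:measure_support \<nu>|\<nu>. 1)"
      by (intro set_lebesgue_integral_cong supp) auto
    also have "\<dots> = (LINT x|\<nu>. 1)"
      unfolding set_lebesgue_integral_def
      using supp by (intro integral_cong_AE) (auto elim!: AE_mp)
    finally show ?thesis by (simp add: prob_space)
  qed
  then have "((\<lambda>\<delta>. ln (LINT x:measure_support \<nu>|\<nu>. measure \<nu> (cball x \<delta>) powr (1 - 1)) / (- ln \<delta>))
      \<longlongrightarrow> 0) (at_right 0)"
    by (intro tendsto_eventually eventually_at_rightI[of 0 1]) auto
  then show ?thesis
    unfolding Lq_spectrum_def by (intro tendsto_Lim) auto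
qed

theorem theorem2p12:
  fixes I :: "'i set"
    and S :: "'i \<Rightarrow> real \<times> real \<Rightarrow> real \<times> real"
    and c d p :: "'i \<Rightarrow> real"
    and \<mu> :: "(real \<times> real) measure"
  assumes "box_like_separated I S c d p \<mu>"
    and "tau1 \<mu> differentiable (at 1)"
    and "tau2 \<mu> differentiable (at 1)"
  shows "gamma I c d p \<mu> differentiable (at 1)
    \<and> (min (deriv (gamma_A I c d p \<mu>) 1) (deriv (gamma_B I c d p \<mu>) 1)
          \<ge> deriv (tau1 \<mu>) 1 + deriv (tau2 \<mu>) 1
        \<longrightarrow> deriv (gamma I c d p \<mu>) 1
          = min (deriv (gamma_A I c d p \<mu>) 1) (deriv (gamma_B I c d p \<mu>) 1))
    \<and> (max (deriv (gamma_A I c d p \<mu>) 1) (deriv (gamma_B I c d p \<mu>) 1)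
          \<le> deriv (tau1 \<mu>) 1 + deriv (tau2 \<mu>) 1
        \<longrightarrow> deriv (gamma I c d p \<mu>) 1
          = max (deriv (gamma_A I c d p \<mu>) 1) (deriv (gamma_B I c d p \<mu>) 1))"
proof -
  interpret box_like_separated I S c d p \<mu> by fact
  interpret prob_space \<mu> by (rule prob_mu)
  interpret W: weighted_system I c d p
    using finite_I c_range d_range p_range p_sum by unfold_locales auto
  have "fst \<in> measurable \<mu> (borel :: real measure)" "snd \<in> measurable \<mu> (borel :: real measure)"
    by (simp_all add: measurable_cong_sets[OF sets_mu refl] borel_prod[symmetric])
  then have tau_1: "tau1 \<mu> 1 = 0" "tau2 \<mu> 1 = 0"
    unfolding tau1_def tau2_def by (simp_all add: Lq_spectrum_1 prob_space_distr)
  define D1 D2 where "D1 = deriv (tau1 \<mu>) 1" and "D2 = deriv (tau2 \<mu>) 1"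
  have D: "(tau1 \<mu> has_real_derivative D1) (at 1)" "(tau2 \<mu> has_real_derivative D2) (at 1)"
    unfolding D1_def D2_def using assms(2,3) by (simp_all add: DERIV_deriv_iff_real_differentiable)
  define h x y where "h = mean_neg_log I p p" and "x = mean_neg_log I p c" and "y = mean_neg_log I p d"
  have xy: "x > 0" "y > 0" unfolding x_def y_def by (rule W.mean_neg_log_pos)+
  define A B where "A = ((y - x) * D1 - h) / y" and "B = ((x - y) * D2 - h) / x"
  have gamma: "gamma I c d p \<mu> = (\<lambda>q. THE s. log_pressure I c d p q (tau1 \<mu> q) (tau2 \<mu> q) s = 0)"
    by (simp add: fun_eq_iff gamma_def W.pressure_eq_exp)
  have gA: "(gamma_A I c d p \<mu> has_real_derivative A) (at 1)"
    using W.DERIV_letter_weight_root[OF D(1) tau_1(1)]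
    by (simp add: gamma_A_def[abs_def] letter_weight_def A_def h_def x_def y_def)
  have gB: "(gamma_B I c d p \<mu> has_real_derivative B) (at 1)"
    using weighted_system.DERIV_letter_weight_root[OF W.swapped D(2) tau_1(2)]
    by (simp add: gamma_B_def[abs_def] letter_weight_def B_def h_def x_def y_def)
  \<comment> \<open>The coordinate with the larger Lyapunov exponent decides; the second case is the
    first one for the exchanged system.\<close>
  have g: "(gamma I c d p \<mu> has_real_derivative (if x \<le> y then A else B)) (at 1)"
  proof (cases "x \<le> y")
    case True
    then show ?thesis
      using W.DERIV_log_pressure_root[OF _ D(1) tau_1(1) D(2) tau_1(2)]
      by (simp add: gamma A_def h_def x_def y_def)
  next
    case False
    then show ?thesis
      using weighted_system.DERIV_log_pressure_root[OF W.swapped _ D(2) tau_1(2) D(1) tau_1(1)]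
      by (simp add: gamma B_def h_def x_def y_def W.log_pressure_swap)
  qed
  \<comment> \<open>The common numerator of \<open>A - (D1 + D2)\<close> and
    \<open>B - (D1 + D2)\<close>. Its sign determines whether dividing by the larger exponent gives
    the smaller or the larger of the two values.\<close>
  define N where "N = - h - x * D1 - y * D2"
  have A: "A = D1 + D2 + N / y" and B: "B = D1 + D2 + N / x"
    using xy by (simp_all add: A_def B_def N_def field_simps)
  have "(if x \<le> y then A else B) = min A B" if "D1 + D2 \<le> min A B"
  proof -
    have "N \<ge> 0" using that xy by (simp add: A zero_le_divide_iff)
    then have "x \<le> y \<Longrightarrow> N / y \<le> N / x" "y \<le> x \<Longrightarrow> N / x \<le> N / y"
      using xy by (auto intro: divide_left_mono)
    then show ?thesis by (auto simp: A B)
  qed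
  moreover have "(if x \<le> y then A else B) = max A B" if "max A B \<le> D1 + D2"
  proof -
    have "N \<le> 0" using that xy by (simp add: A divide_le_0_iff)
    then have "x \<le> y \<Longrightarrow> N / x \<le> N / y" "y \<le> x \<Longrightarrow> N / y \<le> N / x"
      using xy by (auto intro: divide_left_mono_neg)
    then show ?thesis by (auto simp: A B)
  qed
  ultimately show ?thesis
    unfolding DERIV_imp_deriv[OF gA] DERIV_imp_deriv[OF gB] DERIV_imp_deriv[OF g]
      D1_def[symmetric] D2_def[symmetric]
    using g by (auto simp: real_differentiable_def)
qed

end
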